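(* Let $R_N(z;\alpha,\beta,\gamma,\delta)\equiv R_N(y^2-\theta^2;\alpha,\beta,\gamma,\delta)$ be the Racah polynomial of degree $N\le\nu$ ($N$ a positive integer) in the variable $z=y^2-\theta^2$, where $\theta=\frac{\gamma+\delta+1}{2}$ and the parameters $\alpha,\beta,\gamma,\delta$ satisfy (only) one of the conditions $\alpha+1=-\nu$, or $\beta+\delta+1=-\nu$, or $\gamma+1=-\nu$, with $\nu$ a nonnegative integer. Let $\bar z_s=\bar y_s^2-\theta^2$ ($s=1,\dots,N$) be the $N$ zeros of this polynomial, so that $R_N(\bar z_s;\alpha,\beta,\gamma,\delta)=R_N(\bar y_s^2-\theta^2;\alpha,\beta,\gamma,\delta)=0$ for all $s=1,2,\dots,N$; these zeros are assumed to be all different among themselves. Define the $N\times N$ matrix $\underline{\tilde M}$ componentwise as follows: $$\tilde M_{nn}=\frac12\Bigg\{\left[\left(\frac{\tilde D(\bar y_n)}{\bar y_n^2}-\frac{\tilde D'(\bar y_n)}{\bar y_n}\right)(1+2\bar y_n)-2\frac{\tilde D(\bar y_n)}{\bar y_n}\right]\prod_{\ell=1,\,\ell\ne n}^N\left(1+\frac{1+2\bar y_n}{\bar y_n^2-\bar y_\ell^2}\right)$$ $$\qquad+2\frac{\tilde D(\bar y_n)}{\bar y_n}(1+2\bar y_n)\sum_{m=1,\,m\ne n}^N\left[\frac{\bar y_n^2+\bar y_m^2+\bar y_n}{(\bar y_n^2-\bar y_m^2)^2}\prod_{\ell=1,\,\ell\ne n,m}^N\left(1+\frac{1+2\bar y_n}{\bar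 y_n^2-\bar y_\ell^2}\right)\right]+\big[(\bar y_s\to(-\bar y_s))\big]\Bigg\},\quad n=1,\dots,N,$$ and $$\tilde M_{nm}=-\frac{1}{(\bar y_n^2-\bar y_m^2)^2}\Bigg\{\frac{\bar y_m\tilde D(\bar y_n)}{\bar y_n}(1+2\bar y_n)^2\prod_{\ell=1,\,\ell\ne n,m}^N\left(1+\frac{1+2\bar y_n}{\bar y_n^2-\bar y_\ell^2}\right)+\big[(\bar y_s\to(-\bar y_s))\big]\Bigg\},\quad n,m=1,\dots,N,\ n\ne m,$$ where $$\tilde D(y)=\frac{(2y+\gamma+\delta+1)(2y+\gamma-\delta+1)(2y+2\alpha-\gamma-\delta+1)(2y+2\beta-\gamma+\delta+1)}{32\,y\,(2y+1)},$$ $\tilde D'$ is the derivative of $\tilde D$, and the symbol $+[(\bar y_s\to(-\bar y_s))]$ denotes the addition of everything that comes before it within the curly brackets, with $\bar y_s$ replaced by $(-\bar y_s)$ for all $s=1,2,\dots,N$. These matrix elements $\tilde M_{nm}$ are functions of $\bar z_s=\bar y_s^2-\theta^2$, $s=1,2,\dots,N$, because the addition implied by the symbol $+[(\bar y_s\to(-\bar y_s))]$ causes all terms odd in $\bar y_s$ to cancel out (for all values of $s=1,2,\dots,N$). Then this $N\times N$ matrix $\underline{\tilde M}$ has the eigenvalues $$m\,(m-2N-\alpha-\beta-1),\qquad m=1,2,\dots,N.$$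
   Context: The Pochhammer symbol is $(a)_0=1$, $(a)_k=a(a+1)\cdots(a+k-1)$ for $k=1,2,3,\dots$. The Racah polynomial of degree $N$ (with $N=0,1,\dots,\nu$) in the variable $z$ is $$R_N(z;\alpha,\beta,\gamma,\delta)=\sum_{n=0}^N\frac{(-N)_n\,(N+\alpha+\beta+1)_n\,[z]_n}{n!\,(\alpha+1)_n\,(\beta+\delta+1)_n\,(\gamma+1)_n},\qquad [z]_0=1,\quad [z]_n=\prod_{j=0}^{n-1}\left(-z+j(\gamma+\delta+1)+j^2\right).$$ With $z=\lambda(x)=x(x+\gamma+\delta+1)$ one has $[\lambda(x)]_n=(-x)_n(x+\gamma+\delta+1)_n$; with $y=x+\theta$, $\theta=\frac{\gamma+\delta+1}{2}$, one has $\lambda(x)=y^2-\theta^2$. *)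

theory Defs
  imports "HOL-Analysis.Derivative" "Jordan_Normal_Form.Char_Poly"
begin

text \<open>The symbol $[z]_n$; its dependence on $\gamma$ and $\delta$ is explicit.\<close>

definition racah_bracket :: "complex \<Rightarrow> complex \<Rightarrow> complex \<Rightarrow> nat \<Rightarrow> complex" where
  "racah_bracket \<gamma> \<delta> z n =
     (\<Prod>j<n. - z + of_nat j * (\<gamma> + \<delta> + 1) + (of_nat j)\<^sup>2)"

text \<open>If one of the Pochhammer symbols in the denominator vanishes for some \<open>n \<le> N\<close>, then (as
  \<open>x / 0 = 0\<close>) the leading term drops out and the function is a nonzero polynomial in \<open>z\<close>
  of degree less than \<open>N\<close>. Such parameters therefore never admit \<open>N\<close> distinct zeros.\<close>

definition racah ::
  "nat \<Rightarrow> complex \<Rightarrow> complex \<Rightarrow> complex \<Rightarrow> complex \<Rightarrow> complex \<Rightarrow> complex" where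
  "racah N \<alpha> \<beta> \<gamma> \<delta> z =
     (\<Sum>n=0..N. pochhammer (- of_nat N) n * pochhammer (of_nat N + \<alpha> + \<beta> + 1) n
                  * racah_bracket \<gamma> \<delta> z n
        / (fact n * pochhammer (\<alpha> + 1) n * pochhammer (\<beta> + \<delta> + 1) n
             * pochhammer (\<gamma> + 1) n))"

definition racah_theta :: "complex \<Rightarrow> complex \<Rightarrow> complex" where
  "racah_theta \<gamma> \<delta> = (\<gamma> + \<delta> + 1) / 2"

definition D_tilde ::
  "complex \<Rightarrow> complex \<Rightarrow> complex \<Rightarrow> complex \<Rightarrow> complex \<Rightarrow> complex" where
  "D_tilde \<alpha> \<beta> \<gamma> \<delta> y =
     (2 * y + \<gamma> + \<delta> + 1) * (2 * y + \<gamma> - \<delta> + 1)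
       * (2 * y + 2 * \<alpha> - \<gamma> - \<delta> + 1) * (2 * y + 2 * \<beta> - \<gamma> + \<delta> + 1)
     / (32 * y * (2 * y + 1))"

text \<open>The product over \<open>\<ell>\<close> in \<open>{1..N}\<close>, with the indices in \<open>E\<close> excluded.\<close>

definition zero_prod :: "nat \<Rightarrow> (nat \<Rightarrow> complex) \<Rightarrow> nat \<Rightarrow> nat set \<Rightarrow> complex" where
  "zero_prod N y n E = (\<Prod>l\<in>{1..N} - E. 1 + (1 + 2 * y n) / ((y n)\<^sup>2 - (y l)\<^sup>2))"

text \<open>The operation $+[(\bar y_s \to (-\bar y_s))]$, applied to an expression in the whole
  family \<open>y\<close>: all \<open>y s\<close> change sign simultaneously.\<close>

definition add_reflected :: "((nat \<Rightarrow> complex) \<Rightarrow> complex) \<Rightarrow> (nat \<Rightarrow> complex) \<Rightarrow> complex" where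
  "add_reflected F y = F y + F (\<lambda>s. - y s)"

definition M_tilde_diag ::
  "nat \<Rightarrow> complex \<Rightarrow> complex \<Rightarrow> complex \<Rightarrow> complex \<Rightarrow> (nat \<Rightarrow> complex) \<Rightarrow> nat \<Rightarrow> complex" where
  "M_tilde_diag N \<alpha> \<beta> \<gamma> \<delta> y n =
     1 / 2 * add_reflected (\<lambda>y.
       ((D_tilde \<alpha> \<beta> \<gamma> \<delta> (y n) / (y n)\<^sup>2 - deriv (D_tilde \<alpha> \<beta> \<gamma> \<delta>) (y n) / y n)
            * (1 + 2 * y n)
          - 2 * (D_tilde \<alpha> \<beta> \<gamma> \<delta> (y n) / y n))
         * zero_prod N y n {n}
       + 2 * (D_tilde \<alpha> \<beta> \<gamma> \<delta> (y n) / y n) * (1 + 2 * y n)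
         * (\<Sum>m\<in>{1..N} - {n}.
              ((y n)\<^sup>2 + (y m)\<^sup>2 + y n) / ((y n)\<^sup>2 - (y m)\<^sup>2)\<^sup>2 * zero_prod N y n {n, m})) y"

definition M_tilde_offdiag ::
  "nat \<Rightarrow> complex \<Rightarrow> complex \<Rightarrow> complex \<Rightarrow> complex \<Rightarrow> (nat \<Rightarrow> complex) \<Rightarrow> nat \<Rightarrow> nat \<Rightarrow> complex" where
  "M_tilde_offdiag N \<alpha> \<beta> \<gamma> \<delta> y n m =
     - (1 / ((y n)\<^sup>2 - (y m)\<^sup>2)\<^sup>2) * add_reflected (\<lambda>y.
       y m * D_tilde \<alpha> \<beta> \<gamma> \<delta> (y n) / y n * (1 + 2 * y n)\<^sup>2 * zero_prod N y n {n, m}) y"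

text \<open>Matrices are indexed from 0, the zeros from 1.\<close>

definition M_tilde ::
  "nat \<Rightarrow> complex \<Rightarrow> complex \<Rightarrow> complex \<Rightarrow> complex \<Rightarrow> (nat \<Rightarrow> complex) \<Rightarrow> complex Matrix.mat" where
  "M_tilde N \<alpha> \<beta> \<gamma> \<delta> y =
     Matrix.mat N N (\<lambda>(i, j).
       if i = j then M_tilde_diag N \<alpha> \<beta> \<gamma> \<delta> y (Suc i)
       else M_tilde_offdiag N \<alpha> \<beta> \<gamma> \<delta> y (Suc i) (Suc j))"

definition M_tilde_eigenvalue :: "nat \<Rightarrow> complex \<Rightarrow> complex \<Rightarrow> nat \<Rightarrow> complex" where
  "M_tilde_eigenvalue N \<alpha> \<beta> m = of_nat m * (of_nat m - 2 * of_nat N - \<alpha> - \<beta> - 1)"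

end

theory Submission
  imports Defs
begin

text \<open>
  For a function \<open>D\<close> let \<open>T\<close> be the difference operator
  \<open>(T q)(y) = D(y) (q((y+1)\<^sup>2) - q(y\<^sup>2)) + D(-y) (q((y-1)\<^sup>2) - q(y\<^sup>2))\<close>,
  acting on polynomials \<open>q\<close> in \<open>w = y\<^sup>2\<close>. For \<open>D = D_tilde\<close> it is the difference operator of the
  Racah polynomials: with \<open>\<phi>\<^sub>n(w) = \<Prod>\<^sub>j\<^sub><\<^sub>n ((\<theta> + j)\<^sup>2 - w)\<close>, which is \<open>[z]\<^sub>n\<close>, one has
  \<open>T \<phi>\<^sub>n = \<lambda>\<^sub>n \<phi>\<^sub>n - n (\<alpha>+n) (\<beta>+\<delta>+n) (\<gamma>+n) \<phi>\<^sub>n\<^sub>-\<^sub>1\<close> with \<open>\<lambda>\<^sub>n = n (n + \<alpha> + \<beta> + 1)\<close>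
  (\<open>shift_op_racah_basis\<close>), and the coefficients of \<open>R\<^sub>N\<close> are such that \<open>T R\<^sub>N = \<lambda>\<^sub>N R\<^sub>N\<close>
  (\<open>shift_op_racah_poly\<close>). Having \<open>N\<close> distinct zeros, \<open>R\<^sub>N\<close> has degree \<open>N\<close> and is a multiple of
  \<open>P(w) = \<Prod>\<^sub>l (w - y\<^sub>l\<^sup>2)\<close>; hence also \<open>T P = \<lambda>\<^sub>N P\<close>.

  The matrix is the linearization at its equilibrium of the motion of the zeros of a polynomial
  that evolves under \<open>T - \<lambda>\<^sub>N\<close>. Concretely, put \<open>q\<^sub>m = P / (w - y\<^sub>m\<^sup>2)\<close>. Evaluating \<open>T P = \<lambda>\<^sub>N P\<close>
  at \<open>y\<^sub>n\<close> gives the off-diagonal entries the form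
  \<open>M\<^sub>n\<^sub>m = (y\<^sub>m / y\<^sub>n) (T q\<^sub>m)(y\<^sub>n) / q\<^sub>n(y\<^sub>n\<^sup>2)\<close> (\<open>M_tilde_offdiag_eq\<close>). Using also the derivative of
  this equation at \<open>y\<^sub>n\<close>, the diagonal entries take the form
  \<open>M\<^sub>n\<^sub>n = (T q\<^sub>n)(y\<^sub>n) / q\<^sub>n(y\<^sub>n\<^sup>2) - \<lambda>\<^sub>N\<close> (\<open>M_tilde_diag_eq\<close>). By Lagrange interpolation
  (\<open>shift_op_lagrange\<close>), \<open>M\<close> therefore represents \<open>T - \<lambda>\<^sub>N\<close> on the polynomials of degree less
  than \<open>N\<close>. In the basis \<open>\<phi>\<^sub>0, ..., \<phi>\<^sub>N\<^sub>-\<^sub>1\<close> this operator is upper bidiagonal with diagonal entries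
  \<open>\<lambda>\<^sub>k - \<lambda>\<^sub>N\<close>, and these are the asserted eigenvalues for \<open>m = N - k\<close>.
\<close>

section \<open>Interpolation at the nodes\<close>

text \<open>The monic polynomial whose roots are the nodes \<open>w l\<close> with \<open>l \<in> A\<close>.\<close>

definition node_poly :: "('i \<Rightarrow> 'a) \<Rightarrow> 'i set \<Rightarrow> 'a::idom poly" where
  "node_poly w A = (\<Prod>l\<in>A. [:- w l, 1:])"

lemma poly_node_poly: "poly (node_poly w A) x = (\<Prod>l\<in>A. x - w l)"
  by (simp add: node_poly_def poly_prod)

lemma degree_node_poly: "degree (node_poly w A) = card A"
  unfolding node_poly_def by (subst degree_prod_sum_eq) auto

lemma coeff_node_poly_card: "coeff (node_poly w A) (card A) = 1"
  unfolding degree_node_poly[of w A, symmetric] node_poly_def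
  by (simp add: lead_coeff_prod)

lemma node_poly_remove:
  assumes "finite A" "n \<in> A"
  shows "node_poly w A = [:- w n, 1:] * node_poly w (A - {n})"
  unfolding node_poly_def using assms by (rule prod.remove)

lemma poly_node_poly_remove:
  assumes "finite A" "n \<in> A"
  shows "poly (node_poly w A) x = (x - w n) * poly (node_poly w (A - {n})) x"
  unfolding poly_node_poly using assms by (rule prod.remove)

lemma poly_node_poly_eq_0_iff:
  assumes "finite A"
  shows "poly (node_poly w A) x = 0 \<longleftrightarrow> x \<in> w ` A"
  using assms by (auto simp: poly_node_poly)

lemma poly_node_poly_neq_0:
  assumes "finite A" "inj_on w A" "n \<in> A" "B \<subseteq> A" "n \<notin> B"
  shows "poly (node_poly w B) (w n) \<noteq> 0"
  using assms finite_subset[OF assms(4,1)]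
  by (auto simp: poly_node_poly_eq_0_iff inj_on_def)

lemma pderiv_node_poly:
  "pderiv (node_poly w A) = (\<Sum>m\<in>A. node_poly w (A - {m}))"
  by (simp add: node_poly_def pderiv_prod pderiv_pCons)

lemma lagrange_interpolation:
  fixes w :: "'i \<Rightarrow> 'a::field"
  assumes fin: "finite A" and inj: "inj_on w A" and deg: "degree q < card A"
  shows "q = (\<Sum>m\<in>A. Polynomial.smult (poly q (w m) / poly (node_poly w (A - {m})) (w m))
                         (node_poly w (A - {m})))" (is "q = ?r")
proof (rule poly_eqI_degree[of "w ` A"])
  show "card (w ` A) > degree q"
    using deg inj by (simp add: card_image)
  have "degree ?r \<le> card A - 1"
    using fin by (intro degree_sum_le) (auto intro!: order.trans[OF degree_smult_le] simp: degree_node_poly)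
  also have "\<dots> < card A" using deg by simp
  finally show "card (w ` A) > degree ?r"
    using inj by (simp add: card_image)
  fix x assume "x \<in> w ` A"
  then obtain n where n: "n \<in> A" "x = w n" by blast
  have "poly ?r x = (\<Sum>m\<in>A. if m = n then poly q x else 0)"
    unfolding poly_sum
  proof (rule sum.cong[OF refl])
    fix m assume m: "m \<in> A"
    show "poly (Polynomial.smult (poly q (w m) / poly (node_poly w (A - {m})) (w m))
                 (node_poly w (A - {m}))) x = (if m = n then poly q x else 0)"
    proof (cases "m = n")
      case True
      thus ?thesis
        using poly_node_poly_neq_0[OF fin inj n(1), of "A - {n}"] n by auto
    next
      case False
      thus ?thesis using n fin by (simp add: poly_node_poly_eq_0_iff)
    qed
  qed
  also have "\<dots> = poly q x" using n fin by simp
  finally show "poly q x = poly ?r x" by simp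
qed

lemma poly_eq_smult_node_poly:
  assumes "finite A" "inj_on w A" "degree p \<le> card A" "\<And>l. l \<in> A \<Longrightarrow> poly p (w l) = 0"
  shows "p = Polynomial.smult (coeff p (card A)) (node_poly w A)"
proof (rule poly_eqI_degree_lead_coeff[where A = "w ` A" and n = "card A"])
  show "poly.coeff p (card A) = poly.coeff (Polynomial.smult (coeff p (card A)) (node_poly w A)) (card A)"
    by (simp add: coeff_node_poly_card)
  show "degree (Polynomial.smult (coeff p (card A)) (node_poly w A)) \<le> card A"
    using degree_smult_le[of _ "node_poly w A"] by (simp add: degree_node_poly)
  fix x assume "x \<in> w ` A"
  then show "poly p x = poly (Polynomial.smult (coeff p (card A)) (node_poly w A)) x"
    using assms(1,4) poly_node_poly_eq_0_iff[of A w x] by auto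
qed (use assms in \<open>simp_all add: card_image\<close>)

section \<open>The difference operator\<close>

text \<open>The operator \<open>T\<close> from the introduction: it acts on a polynomial \<open>q\<close> in the variable
  \<open>w = y\<^sup>2\<close> and returns a function of \<open>y\<close>, since the coefficient \<open>D\<close> depends on \<open>y\<close>
  itself. The result is even in \<open>y\<close>.\<close>

definition shift_op :: "('a \<Rightarrow> 'a) \<Rightarrow> 'a::comm_ring_1 poly \<Rightarrow> 'a \<Rightarrow> 'a" where
  "shift_op D q y =
     D y * (poly q ((y + 1)\<^sup>2) - poly q (y\<^sup>2)) + D (- y) * (poly q ((y - 1)\<^sup>2) - poly q (y\<^sup>2))"

lemma shift_op_smult: "shift_op D (Polynomial.smult c q) y = c * shift_op D q y"
  by (simp add: shift_op_def algebra_simps)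

lemma shift_op_0: "shift_op D 0 y = 0"
  by (simp add: shift_op_def)

lemma shift_op_add: "shift_op D (p + q) y = shift_op D p y + shift_op D q y"
  by (simp add: shift_op_def algebra_simps)

lemma shift_op_sum: "shift_op D (\<Sum>i\<in>A. f i) y = (\<Sum>i\<in>A. shift_op D (f i) y)"
  by (induction A rule: infinite_finite_induct) (simp_all add: shift_op_add shift_op_0)

lemma shift_op_lagrange:
  fixes w :: "'i \<Rightarrow> 'a::field"
  assumes "finite A" "inj_on w A" "degree q < card A"
  shows "shift_op D q x =
    (\<Sum>m\<in>A. poly q (w m) / poly (node_poly w (A - {m})) (w m)
            * shift_op D (node_poly w (A - {m})) x)"
  by (subst lagrange_interpolation[OF assms]) (simp only: shift_op_sum shift_op_smult)

text \<open>Derivative with respect to \<open>y\<close> of the eigenvalue equation \<open>T p = c p\<close>. At a zero of \<open>p\<close> it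
  is the relation that eliminates \<open>D'\<close> from the diagonal entries of the matrix.\<close>

lemma shift_op_eigen_deriv:
  fixes D :: "complex \<Rightarrow> complex"
  assumes ev: "\<forall>\<^sub>F x in nhds y. shift_op D p x = c * poly p (x\<^sup>2)"
    and D: "D field_differentiable at y" "D field_differentiable at (- y)"
  shows "deriv D y * (poly p ((y + 1)\<^sup>2) - poly p (y\<^sup>2))
       + D y * (2 * (y + 1) * poly (pderiv p) ((y + 1)\<^sup>2) - 2 * y * poly (pderiv p) (y\<^sup>2))
       - deriv D (- y) * (poly p ((y - 1)\<^sup>2) - poly p (y\<^sup>2))
       + D (- y) * (2 * (y - 1) * poly (pderiv p) ((y - 1)\<^sup>2) - 2 * y * poly (pderiv p) (y\<^sup>2))
       = c * (2 * y * poly (pderiv p) (y\<^sup>2))"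
proof -
  have d: "(D has_field_derivative deriv D y) (at y)"
    "(D has_field_derivative deriv D (- y)) (at (- y))"
    using D by (simp_all add: DERIV_deriv_iff_field_differentiable)
  have dm: "((\<lambda>x. D (- x)) has_field_derivative - deriv D (- y)) (at y)"
    using DERIV_chain2[where f = D and g = uminus and x = y, OF d(2) DERIV_minus[OF DERIV_ident]]
    by simp
  have dp: "((\<lambda>x. poly p ((x + a)\<^sup>2)) has_field_derivative
        2 * (y + a) * poly (pderiv p) ((y + a)\<^sup>2)) (at y)" for a
  proof -
    have "((\<lambda>x. (x + a)\<^sup>2) has_field_derivative 2 * (y + a)) (at y)"
      by (auto intro!: derivative_eq_intros)
    from DERIV_chain2[where f = "poly p", OF poly_DERIV this] show ?thesis
      by (simp add: mult.commute)
  qed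
  have dp0: "((\<lambda>x. poly p (x\<^sup>2)) has_field_derivative 2 * y * poly (pderiv p) (y\<^sup>2)) (at y)"
    and dp1: "((\<lambda>x. poly p ((x - 1)\<^sup>2)) has_field_derivative
        2 * (y - 1) * poly (pderiv p) ((y - 1)\<^sup>2)) (at y)"
    using dp[of 0] dp[of "- 1"] by simp_all
  have l: "((\<lambda>x. shift_op D p x) has_field_derivative
      deriv D y * (poly p ((y + 1)\<^sup>2) - poly p (y\<^sup>2))
       + D y * (2 * (y + 1) * poly (pderiv p) ((y + 1)\<^sup>2) - 2 * y * poly (pderiv p) (y\<^sup>2))
       - deriv D (- y) * (poly p ((y - 1)\<^sup>2) - poly p (y\<^sup>2))
       + D (- y) * (2 * (y - 1) * poly (pderiv p) ((y - 1)\<^sup>2) - 2 * y * poly (pderiv p) (y\<^sup>2)))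
      (at y)"
    unfolding shift_op_def
    by (rule DERIV_cong[OF DERIV_add[OF DERIV_mult[OF d(1) DERIV_diff[OF dp[of 1] dp0]]
          DERIV_mult[OF dm DERIV_diff[OF dp1 dp0]]]]) (simp add: algebra_simps)
  have r: "((\<lambda>x. c * poly p (x\<^sup>2)) has_field_derivative c * (2 * y * poly (pderiv p) (y\<^sup>2))) (at y)"
    by (rule DERIV_cmult[OF dp0])
  show ?thesis
    using DERIV_unique[OF l] r DERIV_cong_ev[OF refl ev refl] by blast
qed

section \<open>The matrix entries in terms of the difference operator\<close>

text \<open>The products in the matrix entries are ratios of values of node polynomials, at the shifted
  and at the unshifted argument.\<close>

lemma zero_prod_eq:
  assumes n: "n \<in> {1..N}" "n \<in> E" and inj: "inj_on (\<lambda>l. (y l)\<^sup>2) {1..N}"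
  shows "zero_prod N y n E =
    poly (node_poly (\<lambda>l. (y l)\<^sup>2) ({1..N} - E)) ((y n + 1)\<^sup>2)
      / poly (node_poly (\<lambda>l. (y l)\<^sup>2) ({1..N} - E)) ((y n)\<^sup>2)"
  unfolding zero_prod_def poly_node_poly prod_dividef[symmetric]
proof (rule prod.cong[OF refl])
  fix l assume l: "l \<in> {1..N} - E"
  with n have "(y n)\<^sup>2 - (y l)\<^sup>2 \<noteq> 0"
    using inj_on_eq_iff[OF inj n(1), of l] by auto
  then show "1 + (1 + 2 * y n) / ((y n)\<^sup>2 - (y l)\<^sup>2) =
      ((y n + 1)\<^sup>2 - (y l)\<^sup>2) / ((y n)\<^sup>2 - (y l)\<^sup>2)"
    by (simp add: field_simps power2_eq_square)
qed

lemma zero_prod_remove: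
  assumes n: "n \<in> {1..N}" and m: "m \<in> {1..N}" "m \<noteq> n"
  shows "zero_prod N y n {n} = (1 + (1 + 2 * y n) / ((y n)\<^sup>2 - (y m)\<^sup>2)) * zero_prod N y n {n, m}"
proof -
  have "{1..N} - {n, m} = ({1..N} - {n}) - {m}" by blast
  then show ?thesis
    unfolding zero_prod_def using m by (subst prod.remove[of _ m]) auto
qed

lemma poly_node_poly_shift:
  assumes "n \<in> {1..N}" "n \<in> E" "inj_on (\<lambda>l. (y l)\<^sup>2) {1..N}"
  shows "poly (node_poly (\<lambda>l. (y l)\<^sup>2) ({1..N} - E)) ((y n + 1)\<^sup>2) =
      poly (node_poly (\<lambda>l. (y l)\<^sup>2) ({1..N} - E)) ((y n)\<^sup>2) * zero_prod N y n E"
    and "poly (node_poly (\<lambda>l. (y l)\<^sup>2) ({1..N} - E)) ((y n - 1)\<^sup>2) =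
      poly (node_poly (\<lambda>l. (y l)\<^sup>2) ({1..N} - E)) ((y n)\<^sup>2) * zero_prod N (\<lambda>s. - y s) n E"
proof -
  have nz: "poly (node_poly (\<lambda>l. (y l)\<^sup>2) ({1..N} - E)) ((y n)\<^sup>2) \<noteq> 0"
    using poly_node_poly_neq_0[OF _ assms(3,1), of "{1..N} - E"] assms(2) by auto
  show "poly (node_poly (\<lambda>l. (y l)\<^sup>2) ({1..N} - E)) ((y n + 1)\<^sup>2) =
      poly (node_poly (\<lambda>l. (y l)\<^sup>2) ({1..N} - E)) ((y n)\<^sup>2) * zero_prod N y n E"
    using zero_prod_eq[OF assms] nz by simp
  have "(1 - y n)\<^sup>2 = (y n - 1)\<^sup>2"
    by (rule power2_commute)
  then show "poly (node_poly (\<lambda>l. (y l)\<^sup>2) ({1..N} - E)) ((y n - 1)\<^sup>2) =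
      poly (node_poly (\<lambda>l. (y l)\<^sup>2) ({1..N} - E)) ((y n)\<^sup>2) * zero_prod N (\<lambda>s. - y s) n E"
    using zero_prod_eq[OF assms(1,2), of "\<lambda>s. - y s"] assms(3) nz by simp
qed

text \<open>The formula for the entry contains \<open>(1 + 2 y)\<^sup>2 / (y\<^sub>n\<^sup>2 - y\<^sub>m\<^sup>2)\<^sup>2\<close>, whereas the value of
  \<open>T\<close> on the node polynomial without \<open>m\<close> contains only first powers. The hypothesis \<open>equil\<close>
  reconciles them; it says that \<open>T\<close> of the full node polynomial vanishes at \<open>y\<^sub>n\<close>.\<close>

lemma M_tilde_offdiag_eq:
  fixes y :: "nat \<Rightarrow> complex" and N n :: nat and \<alpha> \<beta> \<gamma> \<delta> :: complex
  defines "w \<equiv> \<lambda>l. (y l)\<^sup>2" and "A \<equiv> {1..N}"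
  defines "D \<equiv> D_tilde \<alpha> \<beta> \<gamma> \<delta>"
  assumes n: "n \<in> A" and m: "m \<in> A" "n \<noteq> m" and inj: "inj_on w A" and y: "y n \<noteq> 0"
    and equil: "D (y n) * poly (node_poly w A) ((y n + 1)\<^sup>2)
              + D (- y n) * poly (node_poly w A) ((y n - 1)\<^sup>2) = 0"
  shows "M_tilde_offdiag N \<alpha> \<beta> \<gamma> \<delta> y n m =
    y m / y n * (shift_op D (node_poly w (A - {m})) (y n) / poly (node_poly w (A - {n})) (w n))"
proof -
  define d where "d = w n - w m"
  define t where "t = 1 + 2 * y n"
  define s where "s = 1 - 2 * y n"
  define G where "G = poly (node_poly w (A - {n, m})) (w n)"
  define Zp where "Zp = zero_prod N y n {n, m}"
  define Zm where "Zm = zero_prod N (\<lambda>s. - y s) n {n, m}"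
  have fin: "finite A" by (simp add: A_def)
  have d: "d \<noteq> 0" using inj_on_eq_iff[OF inj n m(1)] m(2) by (simp add: d_def)
  have G: "G \<noteq> 0"
    unfolding G_def by (rule poly_node_poly_neq_0[OF fin inj n]) auto
  have E: "A - {n} - {m} = A - {n, m}" "A - {m} - {n} = A - {n, m}" by auto
  have Q: "poly (node_poly w (A - {n})) (w n) = d * G"
    using poly_node_poly_remove[of "A - {n}" m w] m fin by (simp add: d_def G_def E(1))
  have q: "node_poly w (A - {m}) = [:- w n, 1:] * node_poly w (A - {n, m})"
    using node_poly_remove[of "A - {m}" n w] n m fin by (simp add: E(2))
  have P: "node_poly w A = [:- w m, 1:] * node_poly w (A - {m})"
    using node_poly_remove[OF fin m(1)] .
  have sp: "poly (node_poly w (A - {n, m})) ((y n + 1)\<^sup>2) = G * Zp"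
    "poly (node_poly w (A - {n, m})) ((y n - 1)\<^sup>2) = G * Zm"
    using poly_node_poly_shift[of n N "{n, m}" y] n inj
    by (simp_all add: A_def w_def G_def Zp_def Zm_def)
  have tp: "(y n + 1)\<^sup>2 = w n + t" and tm: "(y n - 1)\<^sup>2 = w n + s"
    by (simp_all add: w_def t_def s_def power2_eq_square algebra_simps)
  have "D (y n) * (t * (t + d) * (G * Zp)) + D (- y n) * (s * (s + d) * (G * Zm)) = 0"
    using equil sp unfolding P q tp tm by (simp add: d_def algebra_simps)
  then have "G * (D (y n) * t * (t + d) * Zp + D (- y n) * s * (s + d) * Zm) = 0"
    by (simp add: algebra_simps)
  then have eq: "D (y n) * t * (t + d) * Zp + D (- y n) * s * (s + d) * Zm = 0"
    using G by simp
  have T: "shift_op D (node_poly w (A - {m})) (y n) = G * (D (y n) * t * Zp + D (- y n) * s * Zm)"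
    using sp unfolding shift_op_def q tp tm by (simp add: w_def algebra_simps)
  have "M_tilde_offdiag N \<alpha> \<beta> \<gamma> \<delta> y n m =
      - (1 / d\<^sup>2) * (y m * D (y n) / y n * t\<^sup>2 * Zp + y m * D (- y n) / y n * s\<^sup>2 * Zm)"
    by (simp add: M_tilde_offdiag_def add_reflected_def D_def d_def w_def t_def s_def Zp_def Zm_def)
  also have "\<dots> = y m / y n * (- (D (y n) * t\<^sup>2 * Zp + D (- y n) * s\<^sup>2 * Zm) / d\<^sup>2)"
    by (simp add: algebra_simps add_divide_distrib diff_divide_distrib)
  also have "- (D (y n) * t\<^sup>2 * Zp + D (- y n) * s\<^sup>2 * Zm) = d * (D (y n) * t * Zp + D (- y n) * s * Zm)"
  proof -
    have "d * (D (y n) * t * Zp + D (- y n) * s * Zm) + (D (y n) * t\<^sup>2 * Zp + D (- y n) * s\<^sup>2 * Zm)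
        = D (y n) * t * (t + d) * Zp + D (- y n) * s * (s + d) * Zm"
      by (simp add: algebra_simps power2_eq_square)
    with eq show ?thesis by (simp add: add_eq_0_iff2)
  qed
  also have "d * (D (y n) * t * Zp + D (- y n) * s * Zm) / d\<^sup>2 =
      shift_op D (node_poly w (A - {m})) (y n) / poly (node_poly w (A - {n})) (w n)"
    unfolding T Q using d G by (simp add: power2_eq_square)
  finally show ?thesis .
qed

text \<open>The part of a diagonal entry before reflection, with \<open>D\<close> and \<open>D'\<close> standing for the values
  of the coefficient function and its derivative. The last summand is
  \<open>D (1 + 2 y) \<Prod>\<close> times a factor that is even in \<open>y\<close>; it therefore disappears when the reflected
  part is added, because \<open>T\<close> of the full node polynomial vanishes at the node.\<close>

lemma M_tilde_diag_half:
  fixes y :: "nat \<Rightarrow> complex"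
  assumes n: "n \<in> {1..N}" and inj: "inj_on (\<lambda>l. (y l)\<^sup>2) {1..N}" and y: "y n \<noteq> 0"
  shows "((D / (y n)\<^sup>2 - D' / y n) * (1 + 2 * y n) - 2 * (D / y n)) * zero_prod N y n {n}
       + 2 * (D / y n) * (1 + 2 * y n)
         * (\<Sum>m\<in>{1..N} - {n}.
              ((y n)\<^sup>2 + (y m)\<^sup>2 + y n) / ((y n)\<^sup>2 - (y m)\<^sup>2)\<^sup>2 * zero_prod N y n {n, m})
    = - (D' * (1 + 2 * y n) * zero_prod N y n {n} / y n)
      - 2 * D * zero_prod N y n {n} / y n
      - 2 * D * (y n + 1) * (1 + 2 * y n) / y n
          * (\<Sum>m\<in>{1..N} - {n}. zero_prod N y n {n, m} / ((y n)\<^sup>2 - (y m)\<^sup>2))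
      + D * (1 + 2 * y n) * zero_prod N y n {n}
          * (1 / (y n)\<^sup>2 + 2 * (\<Sum>m\<in>{1..N} - {n}. 1 / ((y n)\<^sup>2 - (y m)\<^sup>2)))"
proof -
  have term_eq: "((y n)\<^sup>2 + (y m)\<^sup>2 + y n) / ((y n)\<^sup>2 - (y m)\<^sup>2)\<^sup>2 * zero_prod N y n {n, m} =
      - (y n + 1) * (zero_prod N y n {n, m} / ((y n)\<^sup>2 - (y m)\<^sup>2))
      + y n * zero_prod N y n {n} * (1 / ((y n)\<^sup>2 - (y m)\<^sup>2))"
    if m: "m \<in> {1..N} - {n}" for m
  proof -
    define d where "d = (y n)\<^sup>2 - (y m)\<^sup>2"
    have d: "d \<noteq> 0" using inj_on_eq_iff[OF inj n, of m] m by (auto simp: d_def)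
    have ym: "(y m)\<^sup>2 = (y n)\<^sup>2 - d" by (simp add: d_def)
    have Z: "zero_prod N y n {n} = (1 + (1 + 2 * y n) / d) * zero_prod N y n {n, m}"
      using zero_prod_remove[OF n, of m y] m by (simp add: d_def)
    have "((y n)\<^sup>2 + ((y n)\<^sup>2 - d) + y n) / d\<^sup>2 * u =
      - (y n + 1) * (u / d) + y n * ((1 + (1 + 2 * y n) / d) * u) * (1 / d)" for u
      using d by (simp add: field_simps power2_eq_square)
    then show ?thesis
      unfolding Z d_def[symmetric] unfolding ym .
  qed
  have sum_eq: "(\<Sum>m\<in>{1..N} - {n}.
              ((y n)\<^sup>2 + (y m)\<^sup>2 + y n) / ((y n)\<^sup>2 - (y m)\<^sup>2)\<^sup>2 * zero_prod N y n {n, m}) =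
     - (y n + 1) * (\<Sum>m\<in>{1..N} - {n}. zero_prod N y n {n, m} / ((y n)\<^sup>2 - (y m)\<^sup>2))
      + y n * zero_prod N y n {n} * (\<Sum>m\<in>{1..N} - {n}. 1 / ((y n)\<^sup>2 - (y m)\<^sup>2))"
    unfolding sum_distrib_left sum.distrib[symmetric] by (rule sum.cong[OF refl term_eq])
  have alg: "((D / x\<^sup>2 - D' / x) * t - 2 * (D / x)) * Z + 2 * (D / x) * t * (- (x + 1) * S + x * Z * V) =
     - (D' * t * Z / x) - 2 * D * Z / x - 2 * D * (x + 1) * t / x * S
      + D * t * Z * (1 / x\<^sup>2 + 2 * V)" if "x \<noteq> 0" for x t Z S V :: complex
    using that by (simp add: field_simps power2_eq_square)
  show ?thesis
    unfolding sum_eq by (rule alg[OF y])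
qed

lemma M_tilde_diag_eq:
  fixes y :: "nat \<Rightarrow> complex" and N n :: nat and \<alpha> \<beta> \<gamma> \<delta> :: complex
  defines "w \<equiv> \<lambda>l. (y l)\<^sup>2" and "A \<equiv> {1..N}"
  defines "D \<equiv> D_tilde \<alpha> \<beta> \<gamma> \<delta>"
  assumes n: "n \<in> A" and inj: "inj_on w A" and y: "y n \<noteq> 0"
    and ev: "\<forall>\<^sub>F x in nhds (y n). shift_op D (node_poly w A) x = c * poly (node_poly w A) (x\<^sup>2)"
    and D: "D field_differentiable at (y n)" "D field_differentiable at (- y n)"
  shows "M_tilde_diag N \<alpha> \<beta> \<gamma> \<delta> y n =
    shift_op D (node_poly w (A - {n})) (y n) / poly (node_poly w (A - {n})) (w n) - c"
proof -
  define d where "d = (\<lambda>m. w n - w m)"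
  define t where "t = 1 + 2 * y n"
  define s where "s = 1 - 2 * y n"
  define Q where "Q = poly (node_poly w (A - {n})) (w n)"
  define Zp where "Zp = zero_prod N y n {n}"
  define Zm where "Zm = zero_prod N (\<lambda>s. - y s) n {n}"
  define Sp where "Sp = (\<Sum>m\<in>A - {n}. zero_prod N y n {n, m} / d m)"
  define Sm where "Sm = (\<Sum>m\<in>A - {n}. zero_prod N (\<lambda>s. - y s) n {n, m} / d m)"
  have fin: "finite A" by (simp add: A_def)
  have Q: "Q \<noteq> 0"
    unfolding Q_def by (rule poly_node_poly_neq_0[OF fin inj n]) auto
  have P: "node_poly w A = [:- w n, 1:] * node_poly w (A - {n})"
    using node_poly_remove[OF fin n] .
  have tp: "(y n + 1)\<^sup>2 = w n + t" and tm: "(y n - 1)\<^sup>2 = w n + s"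
    by (simp_all add: w_def t_def s_def power2_eq_square algebra_simps)
  have sh: "poly (node_poly w (A - {n})) (w n + t) = Q * Zp"
    "poly (node_poly w (A - {n})) (w n + s) = Q * Zm"
    using poly_node_poly_shift[of n N "{n}" y] n inj
    unfolding tp[symmetric] tm[symmetric]
    by (simp_all add: A_def w_def Q_def Zp_def Zm_def)
  have shm: "poly (node_poly w (A - {n} - {m})) (w n + t) = Q * (zero_prod N y n {n, m} / d m)"
    "poly (node_poly w (A - {n} - {m})) (w n + s) = Q * (zero_prod N (\<lambda>s. - y s) n {n, m} / d m)"
    if m: "m \<in> A - {n}" for m
  proof -
    have d: "d m \<noteq> 0" using inj_on_eq_iff[OF inj n, of m] m by (auto simp: d_def)
    have "Q = d m * poly (node_poly w (A - {n} - {m})) (w n)"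
      unfolding Q_def using poly_node_poly_remove[of "A - {n}" m w] m fin by (simp add: d_def)
    then have G: "poly (node_poly w (A - {n} - {m})) (w n) = Q / d m"
      using d by simp
    have E: "A - {n} - {m} = A - {n, m}" by blast
    show "poly (node_poly w (A - {n} - {m})) (w n + t) = Q * (zero_prod N y n {n, m} / d m)"
      "poly (node_poly w (A - {n} - {m})) (w n + s) = Q * (zero_prod N (\<lambda>s. - y s) n {n, m} / d m)"
      using poly_node_poly_shift[of n N "{n, m}" y] n inj G
      unfolding tp[symmetric] tm[symmetric] E
      by (simp_all add: A_def w_def)
  qed
  have dq: "poly (pderiv (node_poly w (A - {n}))) (w n + t) = Q * Sp"
    "poly (pderiv (node_poly w (A - {n}))) (w n + s) = Q * Sm"
    unfolding pderiv_node_poly poly_sum Sp_def Sm_def sum_distrib_left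
    by (intro sum.cong refl shm; assumption)+
  have dP: "poly (pderiv (node_poly w A)) (w n) = Q"
    "poly (pderiv (node_poly w A)) (w n + t) = Q * (Zp + t * Sp)"
    "poly (pderiv (node_poly w A)) (w n + s) = Q * (Zm + s * Sm)"
    unfolding P pderiv_mult poly_add poly_mult dq sh
    by (simp_all add: pderiv_pCons Q_def algebra_simps sh[unfolded Q_def])
  have vP: "poly (node_poly w A) (w n) = 0"
    "poly (node_poly w A) (w n + t) = t * (Q * Zp)"
    "poly (node_poly w A) (w n + s) = s * (Q * Zm)"
    unfolding P poly_mult sh by simp_all
  define a where "a = D (y n)"
  define b where "b = D (- y n)"
  define a' where "a' = deriv D (y n)"
  define b' where "b' = deriv D (- y n)"
  define x where "x = y n"
  have wn: "(y n)\<^sup>2 = w n" by (simp add: w_def)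
  have equil: "a * t * Zp + b * s * Zm = 0"
  proof -
    have "shift_op D (node_poly w A) (y n) = c * poly (node_poly w A) ((y n)\<^sup>2)"
      using eventually_nhds_x_imp_x[OF ev] .
    then have "Q * (a * t * Zp + b * s * Zm) = 0"
      unfolding shift_op_def tp tm wn vP a_def b_def by (simp add: algebra_simps)
    then show ?thesis using Q by simp
  qed
  have dd: "a' * t * Zp + a * (2 * (x + 1) * (Zp + t * Sp) - 2 * x)
      - b' * s * Zm + b * (2 * (x - 1) * (Zm + s * Sm) - 2 * x) = 2 * x * c"
  proof -
    have "Q * (a' * t * Zp + a * (2 * (x + 1) * (Zp + t * Sp) - 2 * x)
      - b' * s * Zm + b * (2 * (x - 1) * (Zm + s * Sm) - 2 * x)) = Q * (2 * x * c)"
      using shift_op_eigen_deriv[OF ev D]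
      unfolding tp tm wn vP dP
      unfolding a_def[symmetric] b_def[symmetric] a'_def[symmetric] b'_def[symmetric]
      unfolding x_def[symmetric]
      by (simp add: algebra_simps)
    then show ?thesis using Q by simp
  qed
  have T: "shift_op D (node_poly w (A - {n})) (y n) / Q = a * (Zp - 1) + b * (Zm - 1)"
    unfolding shift_op_def tp tm wn sh a_def[symmetric] b_def[symmetric] Q_def[symmetric]
    using Q by (simp add: field_simps)
  define V where "V = 1 / x\<^sup>2 + 2 * (\<Sum>m\<in>A - {n}. 1 / d m)"
  have M: "M_tilde_diag N \<alpha> \<beta> \<gamma> \<delta> y n = 1 / 2 * (
      (- (a' * t * Zp / x) - 2 * a * Zp / x - 2 * a * (x + 1) * t / x * Sp + a * t * Zp * V)
     + (- (b' * s * Zm / (- x)) - 2 * b * Zm / (- x) - 2 * b * (- x + 1) * s / (- x) * Sm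
         + b * s * Zm * V))"
  proof -
    have h1: "n \<in> {1..N}" "inj_on (\<lambda>l. (y l)\<^sup>2) {1..N}"
      and h2: "inj_on (\<lambda>l. (- y l)\<^sup>2) {1..N}" "- y n \<noteq> 0"
      using n inj y by (simp_all add: A_def w_def)
    show ?thesis
      unfolding M_tilde_diag_def add_reflected_def D_def[symmetric]
      unfolding M_tilde_diag_half[OF h1 y] M_tilde_diag_half[OF h1(1) h2]
      by (simp add: V_def x_def a_def b_def a'_def b'_def t_def s_def Zp_def Zm_def Sp_def Sm_def
           d_def w_def A_def)
  qed
  have x: "x \<noteq> 0" using y by (simp add: x_def)
  have "2 * x * M_tilde_diag N \<alpha> \<beta> \<gamma> \<delta> y n =
      - (a' * t * Zp) - 2 * a * Zp - 2 * a * (x + 1) * t * Sp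
      + b' * s * Zm + 2 * b * Zm + 2 * b * (- x + 1) * s * Sm
      + x * V * (a * t * Zp + b * s * Zm)"
    unfolding M using x by (simp add: field_simps)
  also have "\<dots> = 2 * x * (a * (Zp - 1) + b * (Zm - 1) - c)"
    using dd unfolding equil by (simp add: algebra_simps)
  finally show ?thesis
    using x unfolding T[symmetric] Q_def by simp
qed

section \<open>The Racah polynomial as an eigenfunction\<close>

text \<open>The symbol \<open>[z]\<^sub>n\<close> as a polynomial in \<open>w = z + \<theta>\<^sup>2\<close>: its factors
  \<open>- z + 2 \<theta> j + j\<^sup>2\<close> become \<open>(\<theta> + j)\<^sup>2 - w\<close>.\<close>

definition racah_basis :: "'a::idom \<Rightarrow> nat \<Rightarrow> 'a poly" where
  "racah_basis \<theta> n = (\<Prod>j<n. [:(\<theta> + of_nat j)\<^sup>2, - 1:])"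

lemma racah_bracket_eq_racah_basis:
  assumes "\<theta> = racah_theta \<gamma> \<delta>"
  shows "racah_bracket \<gamma> \<delta> (x - \<theta>\<^sup>2) n = poly (racah_basis \<theta> n) x"
proof -
  have \<theta>: "\<gamma> + \<delta> + 1 = 2 * \<theta>" unfolding assms racah_theta_def by simp
  show ?thesis
    unfolding racah_bracket_def racah_basis_def poly_prod \<theta>
    by (rule prod.cong) (simp_all add: power2_eq_square algebra_simps)
qed

lemma degree_racah_basis: "degree (racah_basis \<theta> n) = n"
  unfolding racah_basis_def by (subst degree_prod_sum_eq) auto

lemma racah_basis_lin_indep:
  fixes v :: "nat \<Rightarrow> 'a::idom"
  assumes "(\<Sum>k<n. Polynomial.smult (v k) (racah_basis \<theta> k)) = 0" and "k < n"
  shows "v k = 0"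
  using assms
proof (induction n arbitrary: k)
  case (Suc n)
  have "coeff (\<Sum>k<n. Polynomial.smult (v k) (racah_basis \<theta> k)) n = 0"
    by (auto simp: coeff_sum coeff_eq_0 degree_racah_basis intro!: sum.neutral)
  then have "coeff (\<Sum>k<Suc n. Polynomial.smult (v k) (racah_basis \<theta> k)) n
      = v n * coeff (racah_basis \<theta> n) n"
    by simp
  moreover have "coeff (racah_basis \<theta> n) n \<noteq> 0"
    using leading_coeff_neq_0[of "racah_basis \<theta> n"]
    by (auto simp: degree_racah_basis) (auto simp: racah_basis_def)
  ultimately have vn: "v n = 0" using Suc.prems(1) by (metis coeff_0 mult_eq_0_iff)
  with Suc show ?case by (cases "k = n") auto
qed simp

lemma poly_racah_basis_pochhammer:
  fixes y \<theta> :: "'a::field_char_0"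
  shows "poly (racah_basis \<theta> n) (y\<^sup>2) = pochhammer (\<theta> - y) n * pochhammer (\<theta> + y) n"
  by (auto simp: racah_basis_def poly_prod pochhammer_prod prod.distrib[symmetric]
      power2_eq_square algebra_simps lessThan_atLeast0 intro!: prod.cong)

text \<open>Shifting \<open>y\<close> by one changes only the outermost factors of the two Pochhammer symbols, and
  the factors \<open>\<theta> + y\<close> and \<open>2 y + 1\<close> of \<open>D_tilde\<close> turn the difference into a multiple of the
  preceding basis polynomial.\<close>

lemma D_tilde_racah_basis_half:
  assumes \<theta>: "\<theta> = racah_theta \<gamma> \<delta>" and y: "y \<noteq> 0" "2 * y + 1 \<noteq> 0"
  shows "D_tilde \<alpha> \<beta> \<gamma> \<delta> y
      * (poly (racah_basis \<theta> (Suc n)) ((y + 1)\<^sup>2) - poly (racah_basis \<theta> (Suc n)) (y\<^sup>2))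
    = - of_nat (Suc n) * poly (racah_basis \<theta> n) (y\<^sup>2)
      * ((\<theta> + of_nat n + y) * (y + (\<gamma> - \<delta> + 1) / 2) * (y + (2 * \<alpha> - \<gamma> - \<delta> + 1) / 2)
          * (y + (2 * \<beta> - \<gamma> + \<delta> + 1) / 2)) / (2 * y)"
proof -
  define K where "K = (y + (\<gamma> - \<delta> + 1) / 2) * (y + (2 * \<alpha> - \<gamma> - \<delta> + 1) / 2)
          * (y + (2 * \<beta> - \<gamma> + \<delta> + 1) / 2)"
  define A where "A = pochhammer (\<theta> - y) n"
  define B where "B = pochhammer (\<theta> + y) n"
  have D: "D_tilde \<alpha> \<beta> \<gamma> \<delta> y = (\<theta> + y) * K / (2 * y * (2 * y + 1))"
  proof -
    have f: "2 * y + \<gamma> + \<delta> + 1 = 2 * (\<theta> + y)"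
      "2 * y + \<gamma> - \<delta> + 1 = 2 * (y + (\<gamma> - \<delta> + 1) / 2)"
      "2 * y + 2 * \<alpha> - \<gamma> - \<delta> + 1 = 2 * (y + (2 * \<alpha> - \<gamma> - \<delta> + 1) / 2)"
      "2 * y + 2 * \<beta> - \<gamma> + \<delta> + 1 = 2 * (y + (2 * \<beta> - \<gamma> + \<delta> + 1) / 2)"
      by (simp_all add: \<theta> racah_theta_def field_simps)
    have "(2 * y + \<gamma> + \<delta> + 1) * (2 * y + \<gamma> - \<delta> + 1)
       * (2 * y + 2 * \<alpha> - \<gamma> - \<delta> + 1) * (2 * y + 2 * \<beta> - \<gamma> + \<delta> + 1)
       = 16 * ((\<theta> + y) * K)"
      unfolding f K_def by (simp only: mult_ac) simp
    then show ?thesis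
      unfolding D_tilde_def using y by (simp add: divide_simps)
  qed
  have 0: "poly (racah_basis \<theta> n) (y\<^sup>2) = A * B"
    by (simp add: poly_racah_basis_pochhammer A_def B_def)
  have 1: "poly (racah_basis \<theta> (Suc n)) (y\<^sup>2) = (\<theta> - y + of_nat n) * (\<theta> + y + of_nat n) * (A * B)"
    by (simp add: poly_racah_basis_pochhammer A_def B_def pochhammer_rec')
  have "pochhammer (\<theta> - (y + 1)) (Suc n) = (\<theta> - y - 1) * A"
    by (simp add: pochhammer_rec A_def algebra_simps)
  moreover have "(\<theta> + y) * pochhammer (\<theta> + (y + 1)) (Suc n)
      = (\<theta> + y + 1 + of_nat n) * (\<theta> + y + of_nat n) * B"
  proof -
    have "(\<theta> + y) * pochhammer (\<theta> + y + 1) (Suc n) = pochhammer (\<theta> + y) (Suc (Suc n))"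
      by (rule pochhammer_rec[symmetric])
    then show ?thesis by (simp add: pochhammer_rec' B_def algebra_simps)
  qed
  ultimately have 2: "(\<theta> + y) * poly (racah_basis \<theta> (Suc n)) ((y + 1)\<^sup>2) =
      (\<theta> - y - 1) * (\<theta> + y + 1 + of_nat n) * (\<theta> + y + of_nat n) * (A * B)"
    unfolding poly_racah_basis_pochhammer by (metis (no_types, lifting) mult.assoc mult.left_commute)
  have "D_tilde \<alpha> \<beta> \<gamma> \<delta> y
      * (poly (racah_basis \<theta> (Suc n)) ((y + 1)\<^sup>2) - poly (racah_basis \<theta> (Suc n)) (y\<^sup>2))
    = K / (2 * y * (2 * y + 1)) * ((\<theta> + y)
      * (poly (racah_basis \<theta> (Suc n)) ((y + 1)\<^sup>2) - poly (racah_basis \<theta> (Suc n)) (y\<^sup>2)))"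
    unfolding D by (simp add: mult_ac)
  also have "(\<theta> + y)
      * (poly (racah_basis \<theta> (Suc n)) ((y + 1)\<^sup>2) - poly (racah_basis \<theta> (Suc n)) (y\<^sup>2))
     = - of_nat (Suc n) * (A * B) * (\<theta> + of_nat n + y) * (2 * y + 1)"
    unfolding right_diff_distrib 2 1 by (simp add: algebra_simps)
  also have "K / (2 * y * (2 * y + 1))
      * (- of_nat (Suc n) * (A * B) * (\<theta> + of_nat n + y) * (2 * y + 1))
    = - of_nat (Suc n) * (A * B) * ((\<theta> + of_nat n + y) * K) / (2 * y)"
    using y by (simp add: divide_simps)
  finally show ?thesis unfolding 0 K_def by (simp only: mult.assoc)
qed

text \<open>The eigenvalue of \<open>T\<close> on polynomials of degree \<open>n\<close>, and the coefficient with which \<open>T\<close> maps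
  the \<open>n\<close>-th basis polynomial to minus its predecessor. The latter vanishes at \<open>n = 0\<close>, so that the
  truncated subtraction in \<open>n - 1\<close> below is harmless.\<close>

definition racah_eigenvalue :: "complex \<Rightarrow> complex \<Rightarrow> nat \<Rightarrow> complex" where
  "racah_eigenvalue \<alpha> \<beta> n = of_nat n * (of_nat n + \<alpha> + \<beta> + 1)"

definition racah_lowering :: "complex \<Rightarrow> complex \<Rightarrow> complex \<Rightarrow> complex \<Rightarrow> nat \<Rightarrow> complex" where
  "racah_lowering \<alpha> \<beta> \<gamma> \<delta> n =
     of_nat n * (\<alpha> + of_nat n) * (\<beta> + \<delta> + of_nat n) * (\<gamma> + of_nat n)"

lemma shift_op_racah_basis:
  assumes \<theta>: "\<theta> = racah_theta \<gamma> \<delta>" and y: "y \<noteq> 0" "2 * y + 1 \<noteq> 0" "2 * (- y) + 1 \<noteq> 0"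
  shows "shift_op (D_tilde \<alpha> \<beta> \<gamma> \<delta>) (racah_basis \<theta> n) y =
    racah_eigenvalue \<alpha> \<beta> n * poly (racah_basis \<theta> n) (y\<^sup>2)
    - racah_lowering \<alpha> \<beta> \<gamma> \<delta> n * poly (racah_basis \<theta> (n - 1)) (y\<^sup>2)"
proof (cases n)
  case 0
  then show ?thesis
    by (simp add: shift_op_def racah_basis_def racah_eigenvalue_def racah_lowering_def)
next
  case (Suc k)
  define g where "g = (\<gamma> - \<delta> + 1) / 2"
  define a where "a = (2 * \<alpha> - \<gamma> - \<delta> + 1) / 2"
  define b where "b = (2 * \<beta> - \<gamma> + \<delta> + 1) / 2"
  define h where "h = \<theta> + of_nat k"
  define P where "P = poly (racah_basis \<theta> k) (y\<^sup>2)"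
  have ym: "- y \<noteq> 0" using y by simp
  have sq: "(- y + 1)\<^sup>2 = (y - 1)\<^sup>2" by (simp add: power2_eq_square algebra_simps)
  have P1: "poly (racah_basis \<theta> (Suc k)) (y\<^sup>2) = (h\<^sup>2 - y\<^sup>2) * P"
    by (simp add: racah_basis_def P_def h_def algebra_simps)
  have l: "\<alpha> + of_nat n = h + a" "\<beta> + \<delta> + of_nat n = h + b" "\<gamma> + of_nat n = h + g"
    "of_nat n + \<alpha> + \<beta> + 1 = h + a + b + g"
    by (simp_all add: h_def a_def b_def g_def \<theta> racah_theta_def Suc field_simps)
  have "shift_op (D_tilde \<alpha> \<beta> \<gamma> \<delta>) (racah_basis \<theta> n) y =
    - of_nat n * P * ((h + y) * (y + g) * (y + a) * (y + b)) / (2 * y)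
    + (- of_nat n * P * ((h + - y) * (- y + g) * (- y + a) * (- y + b)) / (2 * (- y)))"
    using D_tilde_racah_basis_half[OF \<theta> y(1,2), of \<alpha> \<beta> k]
      D_tilde_racah_basis_half[OF \<theta> ym y(3), of \<alpha> \<beta> k]
    unfolding g_def[symmetric] a_def[symmetric] b_def[symmetric] h_def[symmetric] sq
    by (simp add: shift_op_def Suc P_def)
  also have "\<dots> = of_nat n * (h + a + b + g) * ((h\<^sup>2 - y\<^sup>2) * P)
      - of_nat n * (h + a) * (h + b) * (h + g) * P"
    using y(1) by (simp add: divide_simps power2_eq_square) (simp add: algebra_simps)
  finally show ?thesis
    unfolding racah_eigenvalue_def racah_lowering_def l using P1 by (simp add: Suc P_def)
qed

text \<open>The coefficients and the polynomial, in the variable \<open>w = z + \<theta>\<^sup>2\<close>. With \<open>x / 0 = 0\<close>, a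
  coefficient is \<open>0\<close> as soon as a Pochhammer symbol in its denominator vanishes.\<close>

definition racah_coeff ::
  "nat \<Rightarrow> complex \<Rightarrow> complex \<Rightarrow> complex \<Rightarrow> complex \<Rightarrow> nat \<Rightarrow> complex" where
  "racah_coeff N \<alpha> \<beta> \<gamma> \<delta> n =
     pochhammer (- of_nat N) n * pochhammer (of_nat N + \<alpha> + \<beta> + 1) n
        / (fact n * pochhammer (\<alpha> + 1) n * pochhammer (\<beta> + \<delta> + 1) n
             * pochhammer (\<gamma> + 1) n)"

definition racah_poly ::
  "nat \<Rightarrow> complex \<Rightarrow> complex \<Rightarrow> complex \<Rightarrow> complex \<Rightarrow> complex poly" where
  "racah_poly N \<alpha> \<beta> \<gamma> \<delta> = (\<Sum>n\<le>N. Polynomial.smult (racah_coeff N \<alpha> \<beta> \<gamma> \<delta> n)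
      (racah_basis (racah_theta \<gamma> \<delta>) n))"

lemma racah_eq_poly:
  assumes "\<theta> = racah_theta \<gamma> \<delta>"
  shows "racah N \<alpha> \<beta> \<gamma> \<delta> (x - \<theta>\<^sup>2) = poly (racah_poly N \<alpha> \<beta> \<gamma> \<delta>) x"
  unfolding racah_def racah_poly_def poly_sum atLeast0AtMost
  by (rule sum.cong) (simp_all add: racah_bracket_eq_racah_basis[OF assms] racah_coeff_def assms[symmetric])

lemma degree_racah_poly_le: "degree (racah_poly N \<alpha> \<beta> \<gamma> \<delta>) \<le> N"
  unfolding racah_poly_def
  by (intro degree_sum_le) (auto intro!: order.trans[OF degree_smult_le] simp: degree_racah_basis)

lemma racah_poly_neq_0: "racah_poly N \<alpha> \<beta> \<gamma> \<delta> \<noteq> 0"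
proof -
  let ?\<theta> = "racah_theta \<gamma> \<delta>"
  have "poly (racah_basis ?\<theta> n) (?\<theta>\<^sup>2) = (if n = 0 then 1 else 0)" for n
    by (cases n) (simp_all add: racah_basis_def prod.lessThan_Suc_shift del: prod.lessThan_Suc)
  then have "poly (racah_poly N \<alpha> \<beta> \<gamma> \<delta>) (?\<theta>\<^sup>2) = racah_coeff N \<alpha> \<beta> \<gamma> \<delta> 0"
    by (simp add: racah_poly_def poly_sum if_distrib[where f = "\<lambda>u. _ * u"] cong: if_cong)
  also have "\<dots> = 1" by (simp add: racah_coeff_def)
  finally have "poly (racah_poly N \<alpha> \<beta> \<gamma> \<delta>) (?\<theta>\<^sup>2) = 1" .
  then show ?thesis by auto
qed

text \<open>The two-term recurrence that the eigenvalue equation imposes on the coefficients. Since the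
  last coefficient is nonzero, no factor of the denominators vanishes.\<close>

lemma racah_coeff_Suc:
  assumes "n < N" and nz: "racah_coeff N \<alpha> \<beta> \<gamma> \<delta> N \<noteq> 0"
  shows "racah_coeff N \<alpha> \<beta> \<gamma> \<delta> (Suc n) * racah_lowering \<alpha> \<beta> \<gamma> \<delta> (Suc n) =
    racah_coeff N \<alpha> \<beta> \<gamma> \<delta> n * (racah_eigenvalue \<alpha> \<beta> n - racah_eigenvalue \<alpha> \<beta> N)"
proof -
  have *: "x + of_nat n \<noteq> 0" if "pochhammer x N \<noteq> 0" for x :: complex
    using that \<open>n < N\<close> pochhammer_eq_0_iff[of x N] by (metis add_eq_0_iff2)
  have nz': "\<alpha> + 1 + of_nat n \<noteq> 0" "\<beta> + \<delta> + 1 + of_nat n \<noteq> 0" "\<gamma> + 1 + of_nat n \<noteq> 0"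
    using nz by (auto simp: racah_coeff_def intro!: *)
  have f: "1 + of_nat n \<noteq> (0 :: complex)"
    by (metis of_nat_Suc of_nat_eq_0_iff nat.distinct(1))
  have e: "racah_eigenvalue \<alpha> \<beta> n - racah_eigenvalue \<alpha> \<beta> N =
      (- of_nat N + of_nat n) * (of_nat N + \<alpha> + \<beta> + 1 + of_nat n)"
    by (simp add: racah_eigenvalue_def algebra_simps)
  have l: "racah_lowering \<alpha> \<beta> \<gamma> \<delta> (Suc n) =
      (1 + of_nat n) * (\<alpha> + 1 + of_nat n) * (\<beta> + \<delta> + 1 + of_nat n) * (\<gamma> + 1 + of_nat n)"
    by (simp add: racah_lowering_def algebra_simps)
  have alg: "(p * u) * (q * v) / ((1 + of_nat n) * F * (A * a) * (B * b) * (G * g))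
      * ((1 + of_nat n) * a * b * g) = p * q / (F * A * B * G) * (u * v)"
    if "a \<noteq> 0" "b \<noteq> 0" "g \<noteq> 0" for p q u v A B G F a b g :: complex
    using that f by (simp add: mult_ac)
  show ?thesis
    unfolding e l racah_coeff_def pochhammer_Suc fact_Suc of_nat_Suc by (rule alg[OF nz'])
qed

lemma shift_op_racah_poly:
  assumes nz: "racah_coeff N \<alpha> \<beta> \<gamma> \<delta> N \<noteq> 0"
    and y: "y \<noteq> 0" "2 * y + 1 \<noteq> 0" "2 * (- y) + 1 \<noteq> 0"
  shows "shift_op (D_tilde \<alpha> \<beta> \<gamma> \<delta>) (racah_poly N \<alpha> \<beta> \<gamma> \<delta>) y =
    racah_eigenvalue \<alpha> \<beta> N * poly (racah_poly N \<alpha> \<beta> \<gamma> \<delta>) (y\<^sup>2)"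
proof -
  let ?\<theta> = "racah_theta \<gamma> \<delta>" and ?D = "D_tilde \<alpha> \<beta> \<gamma> \<delta>"
  let ?c = "racah_coeff N \<alpha> \<beta> \<gamma> \<delta>" and ?e = "racah_eigenvalue \<alpha> \<beta>"
  let ?p = "\<lambda>n. poly (racah_basis ?\<theta> n) (y\<^sup>2)"
  \<comment> \<open>By the recurrence the sum telescopes; what remains at \<open>k\<close> vanishes for \<open>k = N\<close>.\<close>
  have partial: "(\<Sum>n\<le>k. ?c n * (shift_op ?D (racah_basis ?\<theta> n) y - ?e N * ?p n)) =
      ?c k * (?e k - ?e N) * ?p k" if "k \<le> N" for k
    using that
  proof (induction k)
    case 0
    show ?case
      by (simp add: shift_op_racah_basis[OF refl y] racah_lowering_def algebra_simps)
  next
    case (Suc k)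
    have "?c (Suc k) * (shift_op ?D (racah_basis ?\<theta> (Suc k)) y - ?e N * ?p (Suc k)) =
      ?c (Suc k) * (?e (Suc k) - ?e N) * ?p (Suc k)
      - (?c (Suc k) * racah_lowering \<alpha> \<beta> \<gamma> \<delta> (Suc k)) * ?p k"
      by (simp add: shift_op_racah_basis[OF refl y] algebra_simps)
    also have "?c (Suc k) * racah_lowering \<alpha> \<beta> \<gamma> \<delta> (Suc k) = ?c k * (?e k - ?e N)"
      using Suc.prems by (intro racah_coeff_Suc nz) simp
    finally show ?case using Suc by (simp del: of_nat_Suc)
  qed
  have "shift_op ?D (racah_poly N \<alpha> \<beta> \<gamma> \<delta>) y - ?e N * poly (racah_poly N \<alpha> \<beta> \<gamma> \<delta>) (y\<^sup>2) =
      (\<Sum>n\<le>N. ?c n * (shift_op ?D (racah_basis ?\<theta> n) y - ?e N * ?p n))"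
    by (simp add: racah_poly_def shift_op_sum shift_op_smult poly_sum sum_distrib_left
        sum_subtractf[symmetric] algebra_simps)
  also have "\<dots> = 0" by (simp add: partial)
  finally show ?thesis by simp
qed

lemma D_tilde_field_differentiable:
  assumes "y \<noteq> 0" "2 * y + 1 \<noteq> 0"
  shows "D_tilde \<alpha> \<beta> \<gamma> \<delta> field_differentiable at y"
proof -
  have eq: "D_tilde \<alpha> \<beta> \<gamma> \<delta> = (\<lambda>y. (2 * y + \<gamma> + \<delta> + 1) * (2 * y + \<gamma> - \<delta> + 1)
       * (2 * y + 2 * \<alpha> - \<gamma> - \<delta> + 1) * (2 * y + 2 * \<beta> - \<gamma> + \<delta> + 1)
     / (32 * y * (2 * y + 1)))"
    by (rule ext) (rule D_tilde_def)
  show ?thesis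
    unfolding eq field_differentiable_def
    by (rule exI) (rule derivative_eq_intros refl | use assms in simp)+
qed

section \<open>Similarity to a bidiagonal matrix\<close>

lemma similar_mat_of_intertwining:
  fixes M U W :: "'a::field mat"
  assumes M: "M \<in> carrier_mat n n" and U: "U \<in> carrier_mat n n" and W: "W \<in> carrier_mat n n"
    and eq: "M * W = W * U"
    and ker: "\<And>v. v \<in> carrier_vec n \<Longrightarrow> W *\<^sub>v v = 0\<^sub>v n \<Longrightarrow> v = 0\<^sub>v n"
  shows "similar_mat M U"
proof -
  have "det W \<noteq> 0"
    using ker det_0_iff_vec_prod_zero[OF W] by blast
  from det_non_zero_imp_unit[OF W this, of "()"]
  obtain B where B: "B \<in> carrier_mat n n" "B * W = 1\<^sub>m n" "W * B = 1\<^sub>m n"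
    unfolding Units_def ring_mat_def by auto
  have "W * U * B = M * W * B" by (simp add: eq)
  also have "\<dots> = M * (W * B)" using M W B(1) by (rule assoc_mult_mat)
  also have "\<dots> = M" using M B(3) by simp
  finally have "M = W * U * B" by simp
  then show ?thesis
    using M U W B by (intro similar_matI[of M U W B n]) auto
qed

text \<open>The eigenvalues of the matrix are those of \<open>T\<close> on polynomials of degree \<open>k < N\<close>, shifted by
  the eigenvalue at \<open>N\<close>, with \<open>m = N - k\<close>.\<close>

lemma M_tilde_eigenvalue_eq:
  assumes "k \<le> N"
  shows "M_tilde_eigenvalue N \<alpha> \<beta> (N - k) = racah_eigenvalue \<alpha> \<beta> k - racah_eigenvalue \<alpha> \<beta> N"
  using assms by (simp add: M_tilde_eigenvalue_def racah_eigenvalue_def of_nat_diff algebra_simps)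

theorem proposition2p2:
  fixes N \<nu> :: nat and \<alpha> \<beta> \<gamma> \<delta> \<theta> :: complex and y z :: "nat \<Rightarrow> complex"
  assumes N: "1 \<le> N" "N \<le> \<nu>"
    and params:
      "(\<alpha> + 1 = - of_nat \<nu> \<and> \<beta> + \<delta> + 1 \<noteq> - of_nat \<nu> \<and> \<gamma> + 1 \<noteq> - of_nat \<nu>) \<or>
       (\<alpha> + 1 \<noteq> - of_nat \<nu> \<and> \<beta> + \<delta> + 1 = - of_nat \<nu> \<and> \<gamma> + 1 \<noteq> - of_nat \<nu>) \<or>
       (\<alpha> + 1 \<noteq> - of_nat \<nu> \<and> \<beta> + \<delta> + 1 \<noteq> - of_nat \<nu> \<and> \<gamma> + 1 = - of_nat \<nu>)"
    and theta: "\<theta> = racah_theta \<gamma> \<delta>"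
    and z: "\<And>s. s \<in> {1..N} \<Longrightarrow> z s = (y s)\<^sup>2 - \<theta>\<^sup>2"
    and zeros: "\<And>s. s \<in> {1..N} \<Longrightarrow> racah N \<alpha> \<beta> \<gamma> \<delta> (z s) = 0"
    and distinct: "inj_on z {1..N}"
    and denominators: "\<And>s. s \<in> {1..N} \<Longrightarrow> y s \<noteq> 0 \<and> 2 * y s + 1 \<noteq> 0 \<and> 2 * (- y s) + 1 \<noteq> 0"
  shows "char_poly (M_tilde N \<alpha> \<beta> \<gamma> \<delta> y) = (\<Prod>m=1..N. [:- M_tilde_eigenvalue N \<alpha> \<beta> m, 1:])
    \<and> {k. eigenvalue (M_tilde N \<alpha> \<beta> \<gamma> \<delta> y) k} = M_tilde_eigenvalue N \<alpha> \<beta> ` {1..N}"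
proof -
  define A where "A = {1..N}"
  define w where "w = (\<lambda>l. (y l)\<^sup>2)"
  define D where "D = D_tilde \<alpha> \<beta> \<gamma> \<delta>"
  define ev where "ev = racah_eigenvalue \<alpha> \<beta>"
  define R where "R = racah_poly N \<alpha> \<beta> \<gamma> \<delta>"
  define M where "M = M_tilde N \<alpha> \<beta> \<gamma> \<delta> y"
  define Q where "Q = (\<lambda>n. poly (node_poly w (A - {n})) (w n))"
  have fin: "finite A" and card: "card A = N" by (simp_all add: A_def)
  have inj: "inj_on w A"
  proof (rule inj_onI)
    fix m n assume "m \<in> A" "n \<in> A" "w m = w n"
    then show "m = n"
      using inj_onD[OF distinct, of m n] z by (simp add: A_def w_def)
  qed
  have yA: "y n \<noteq> 0" "2 * y n + 1 \<noteq> 0" "2 * (- y n) + 1 \<noteq> 0" if "n \<in> A" for n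
    using denominators that by (simp_all add: A_def)
  have QA: "Q n \<noteq> 0" if "n \<in> A" for n
    unfolding Q_def by (rule poly_node_poly_neq_0[OF fin inj that]) auto
  have R_zero: "poly R (w n) = 0" if "n \<in> A" for n
    using zeros[of n] z[of n] that
    by (simp add: A_def w_def R_def racah_eq_poly[OF theta])
  have degR: "degree R \<le> N" unfolding R_def by (rule degree_racah_poly_le)
  have R: "R = Polynomial.smult (coeff R N) (node_poly w A)"
    using poly_eq_smult_node_poly[OF fin inj, of R] R_zero degR by (simp add: card)
  have cR: "coeff R N \<noteq> 0"
    using R racah_poly_neq_0[of N \<alpha> \<beta> \<gamma> \<delta>] by (auto simp: R_def)
  \<comment> \<open>\<open>N\<close> distinct zeros force degree exactly \<open>N\<close>, hence a nonzero last coefficient.\<close>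
  have cN: "racah_coeff N \<alpha> \<beta> \<gamma> \<delta> N \<noteq> 0"
  proof
    assume 0: "racah_coeff N \<alpha> \<beta> \<gamma> \<delta> N = 0"
    have "coeff (racah_basis (racah_theta \<gamma> \<delta>) n) N = 0" if "n < N" for n
      using that by (simp add: coeff_eq_0 degree_racah_basis)
    then have "coeff R N = 0"
      unfolding R_def racah_poly_def coeff_sum coeff_smult
      using 0 by (intro sum.neutral) (auto simp: le_less)
    with cR show False by simp
  qed
  have eigen: "shift_op D (node_poly w A) x = ev N * poly (node_poly w A) (x\<^sup>2)"
    if "x \<noteq> 0" "2 * x + 1 \<noteq> 0" "2 * (- x) + 1 \<noteq> 0" for x
  proof -
    have "shift_op D R x = ev N * poly R (x\<^sup>2)"
      unfolding D_def R_def ev_def by (rule shift_op_racah_poly[OF cN that])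
    then have "coeff R N * shift_op D (node_poly w A) x
        = coeff R N * (ev N * poly (node_poly w A) (x\<^sup>2))"
      by (subst (asm) (1 2) R) (simp add: shift_op_smult mult_ac)
    with cR show ?thesis by simp
  qed
  have P0: "poly (node_poly w A) ((y n)\<^sup>2) = 0" if "n \<in> A" for n
    using poly_node_poly_eq_0_iff[OF fin, of w] that by (auto simp: w_def)
  \<comment> \<open>Hence \<open>M\<close> represents \<open>T - \<lambda>\<^sub>N\<close> in the basis \<open>y\<^sub>n q\<^sub>n\<close>, where \<open>Q n\<close> is the value of \<open>q\<^sub>n\<close> at
    its own node.\<close>
  have entry: "M $$ (i, j) = y m / y n * (shift_op D (node_poly w (A - {m})) (y n) / Q n)
      - (if i = j then ev N else 0)"
    if ij: "i < N" "j < N" and nm: "n = Suc i" "m = Suc j" for i j n m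
  proof (cases "i = j")
    case True
    have n: "n \<in> A" using ij nm by (simp add: A_def)
    have "\<forall>\<^sub>F x in nhds (y n). x \<noteq> 0 \<and> x \<noteq> - 1 / 2 \<and> x \<noteq> 1 / 2"
      using yA[OF n]
      by (intro eventually_conj t1_space_nhds) (auto simp: eq_divide_eq mult.commute[of _ 2])
    then have evt: "\<forall>\<^sub>F x in nhds (y n).
        shift_op D (node_poly w A) x = ev N * poly (node_poly w A) (x\<^sup>2)"
    proof (rule eventually_mono)
      fix x :: complex
      assume x: "x \<noteq> 0 \<and> x \<noteq> - 1 / 2 \<and> x \<noteq> 1 / 2"
      show "shift_op D (node_poly w A) x = ev N * poly (node_poly w A) (x\<^sup>2)"
      proof (rule eigen)
        show "x \<noteq> 0" using x by simp
        have "2 * x + 1 = 2 * (x - (- 1 / 2))" "2 * (- x) + 1 = 2 * (1 / 2 - x)"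
          by (simp_all add: algebra_simps)
        with x show "2 * x + 1 \<noteq> 0" "2 * (- x) + 1 \<noteq> 0"
          by (metis eq_iff_diff_eq_0 mult_eq_0_iff zero_neq_numeral)+
      qed
    qed
    have "D field_differentiable at (y n)" "D field_differentiable at (- y n)"
      unfolding D_def using yA[OF n] by (intro D_tilde_field_differentiable; simp)+
    from M_tilde_diag_eq[OF n[unfolded A_def] inj[unfolded A_def w_def] yA(1)[OF n]
        evt[unfolded A_def w_def D_def] this[unfolded D_def]]
    show ?thesis
      using True ij nm yA(1)[OF n] by (simp add: M_def M_tilde_def A_def w_def D_def Q_def)
  next
    case False
    have n: "n \<in> A" "m \<in> A" "n \<noteq> m" using ij nm False by (simp_all add: A_def)
    have "D (y n) * poly (node_poly w A) ((y n + 1)\<^sup>2)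
        + D (- y n) * poly (node_poly w A) ((y n - 1)\<^sup>2) = 0"
      using eigen[OF yA[OF n(1)]] P0[OF n(1)] by (simp add: shift_op_def)
    from M_tilde_offdiag_eq[OF n[unfolded A_def] inj[unfolded A_def w_def] yA(1)[OF n(1)]
        this[unfolded A_def w_def D_def]]
    show ?thesis
      using False ij nm by (simp add: M_def M_tilde_def A_def w_def D_def Q_def)
  qed
  define \<phi> where "\<phi> = (racah_basis \<theta> :: nat \<Rightarrow> complex poly)"
  define b where "b = racah_lowering \<alpha> \<beta> \<gamma> \<delta>"
  \<comment> \<open>The columns of \<open>W\<close> are the coordinates of the \<open>\<phi> k\<close> in the basis \<open>y\<^sub>n q\<^sub>n\<close>, and \<open>U\<close> represents
    \<open>T - \<lambda>\<^sub>N\<close> in the basis of the \<open>\<phi> k\<close>.\<close>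
  define W where "W = Matrix.mat N N (\<lambda>(i, k). poly (\<phi> k) (w (Suc i)) / (y (Suc i) * Q (Suc i)))"
  define U where "U = Matrix.mat N N (\<lambda>(j, k).
      if j = k then M_tilde_eigenvalue N \<alpha> \<beta> (N - k) else if Suc j = k then - b k else 0)"
  have carr: "M \<in> carrier_mat N N" "U \<in> carrier_mat N N" "W \<in> carrier_mat N N"
    by (simp_all add: M_def M_tilde_def U_def W_def)
  have MW: "M * W = W * U"
  proof (rule eq_matI)
    show "dim_row (M * W) = dim_row (W * U)" "dim_col (M * W) = dim_col (W * U)"
      using carr by auto
    fix i k assume "i < dim_row (W * U)" "k < dim_col (W * U)"
    then have i: "i < N" and k: "k < N" using carr by auto
    define n where "n = Suc i"
    have n: "n \<in> A" using i by (simp add: n_def A_def)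
    have "(M * W) $$ (i, k) = (\<Sum>j<N. M $$ (i, j) * W $$ (j, k))"
      using i k carr by (simp add: scalar_prod_def lessThan_atLeast0)
    also have "\<dots> = (\<Sum>j<N. (poly (\<phi> k) (w (Suc j)) / Q (Suc j)
            * shift_op D (node_poly w (A - {Suc j})) (y n)) / (y n * Q n)
          - (if i = j then ev N * poly (\<phi> k) (w n) / (y n * Q n) else 0))"
    proof (rule sum.cong[OF refl])
      fix j assume "j \<in> {..<N}"
      then have j: "j < N" "Suc j \<in> A" by (simp_all add: A_def)
      show "M $$ (i, j) * W $$ (j, k) = (poly (\<phi> k) (w (Suc j)) / Q (Suc j)
            * shift_op D (node_poly w (A - {Suc j})) (y n)) / (y n * Q n)
          - (if i = j then ev N * poly (\<phi> k) (w n) / (y n * Q n) else 0)"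
        unfolding entry[OF i j(1) n_def refl]
        using j k yA(1)[OF j(2)] by (simp add: W_def n_def left_diff_distrib)
            (simp add: diff_divide_distrib mult_ac)
    qed
    also have "\<dots> = (\<Sum>m\<in>A. poly (\<phi> k) (w m) / Q m
            * shift_op D (node_poly w (A - {m})) (y n)) / (y n * Q n)
          - ev N * poly (\<phi> k) (w n) / (y n * Q n)"
      using i by (simp add: sum_subtractf sum_divide_distrib A_def sum.atLeast1_atMost_eq)
    also have "(\<Sum>m\<in>A. poly (\<phi> k) (w m) / Q m * shift_op D (node_poly w (A - {m})) (y n)) =
        shift_op D (\<phi> k) (y n)"
      unfolding Q_def
      by (rule shift_op_lagrange[OF fin inj, symmetric]) (simp add: \<phi>_def degree_racah_basis card k)
    also have "\<dots> = ev k * poly (\<phi> k) (w n) - b k * poly (\<phi> (k - 1)) (w n)"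
      unfolding D_def \<phi>_def ev_def b_def w_def by (rule shift_op_racah_basis[OF theta yA[OF n]])
    also have "(ev k * poly (\<phi> k) (w n) - b k * poly (\<phi> (k - 1)) (w n)) / (y n * Q n)
          - ev N * poly (\<phi> k) (w n) / (y n * Q n)
        = (ev k - ev N) * W $$ (i, k) - b k * (poly (\<phi> (k - 1)) (w n) / (y n * Q n))"
      using i k by (simp add: W_def n_def diff_divide_distrib left_diff_distrib)
    also have "\<dots> = (\<Sum>j<N. W $$ (i, j) * U $$ (j, k))"
    proof -
      have "(\<Sum>j<N. W $$ (i, j) * U $$ (j, k)) =
          (\<Sum>j<N. (if j = k then W $$ (i, k) * (ev k - ev N) else 0)
            + (if Suc j = k then - b k * W $$ (i, j) else 0))"
        using k by (intro sum.cong) (auto simp: U_def M_tilde_eigenvalue_eq ev_def)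
      also have "\<dots> = W $$ (i, k) * (ev k - ev N)
          + (\<Sum>j<N. if Suc j = k then - b k * W $$ (i, j) else 0)"
        using k by (simp add: sum.distrib)
      also have "(\<Sum>j<N. if Suc j = k then - b k * W $$ (i, j) else 0) =
          - b k * (poly (\<phi> (k - 1)) (w n) / (y n * Q n))"
      proof (cases k)
        case 0
        then show ?thesis by (simp add: b_def racah_lowering_def)
      next
        case (Suc k')
        then show ?thesis using i k by (simp add: W_def n_def)
      qed
      finally show ?thesis by (simp add: algebra_simps)
    qed
    also have "\<dots> = (W * U) $$ (i, k)"
      using i k carr by (simp add: scalar_prod_def lessThan_atLeast0)
    finally show "(M * W) $$ (i, k) = (W * U) $$ (i, k)" .
  qed
  have "v = 0\<^sub>v N" if v: "v \<in> carrier_vec N" "W *\<^sub>v v = 0\<^sub>v N" for v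
  proof -
    define p where "p = (\<Sum>k<N. Polynomial.smult (vec_index v k) (\<phi> k))"
    have "p = 0"
    proof (rule poly_eqI_degree[of "w ` A"])
      have "degree p \<le> N - 1"
        unfolding p_def
        by (intro degree_sum_le) (auto intro!: order.trans[OF degree_smult_le]
              simp: degree_racah_basis \<phi>_def)
      then show "degree p < card (w ` A)" using N by (simp add: card_image inj card)
      show "degree (0 :: complex poly) < card (w ` A)" using N by (simp add: card_image inj card)
      fix x assume "x \<in> w ` A"
      then obtain n where n: "n \<in> A" "x = w n" by blast
      define i where "i = n - 1"
      have i: "i < N" "Suc i = n" using n by (auto simp: A_def i_def)
      have "0 = vec_index (W *\<^sub>v v) i" using v i by simp
      also have "\<dots> = (\<Sum>k<N. poly (\<phi> k) (w n) / (y n * Q n) * vec_index v k)"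
        using i v(1) carr(3) by (simp add: scalar_prod_def lessThan_atLeast0 W_def)
      also have "\<dots> = poly p x / (y n * Q n)"
        by (simp add: p_def poly_sum sum_divide_distrib n mult_ac)
      finally show "poly p x = poly 0 x" using yA(1)[OF n(1)] QA[OF n(1)] by simp
    qed
    then have "vec_index v k = 0" if "k < N" for k
      using racah_basis_lin_indep[of "vec_index v" \<theta> N k] that by (simp add: p_def \<phi>_def)
    then show ?thesis using v(1) by (intro eq_vecI) auto
  qed
  then have "char_poly M = char_poly U"
    by (intro char_poly_similar similar_mat_of_intertwining[OF carr MW])
  also have "\<dots> = (\<Prod>a\<leftarrow>diag_mat U. [:- a, 1:])"
    by (rule char_poly_upper_triangular[OF carr(2)]) (auto simp: upper_triangular_def U_def)
  also have "\<dots> = (\<Prod>k<N. [:- M_tilde_eigenvalue N \<alpha> \<beta> (N - k), 1:])"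
    by (simp add: diag_mat_def U_def comp_def prod.list_conv_set_nth lessThan_atLeast0)
  also have "\<dots> = (\<Prod>m=1..N. [:- M_tilde_eigenvalue N \<alpha> \<beta> m, 1:])"
    by (rule prod.reindex_bij_witness[of _ "\<lambda>m. N - m" "\<lambda>k. N - k"]) auto
  finally have char: "char_poly M = (\<Prod>m=1..N. [:- M_tilde_eigenvalue N \<alpha> \<beta> m, 1:])" .
  moreover have "{k. eigenvalue M k} = M_tilde_eigenvalue N \<alpha> \<beta> ` {1..N}"
    unfolding eigenvalue_root_char_poly[OF carr(1)] char poly_prod by auto
  ultimately show ?thesis unfolding M_def ..
qed

end
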